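(* Let $\mathcal X\subset\mathbb R^m$ be compact, $A\in\mathbb R^{d\times m}$, $b\in\mathbb R^d$, $\alpha>0$, $\beta>0$, and let $g:\mathbb R^d\to\mathbb R$ be convex and differentiable with globally $\frac1\beta$-Lipschitz gradient. Let $\bar\mu$ be the target measure of one of the sampling schemes (S1), (S2) described in the context, and let $z_{\bar\mu}$ denote the unique minimizer over $\mathbb R^d$ of $z\mapsto\mathbb E_{X\sim\bar\mu}[\ell(X,z)]$, where $\ell(x,z)=\exp(\alpha g^*(-z/\alpha)-\langle b,z\rangle+\langle A^\top z,x\rangle)$. Let $r>0$ be such that $B_r\subset\mathrm{int}(\mathrm{dom}(g^*(-(\cdot)/\alpha)))$ and $z_{\bar\mu}\in B_r$. Suppose that the stepsizes $\beta_k\ge0$ and batch sizes $m_k\in\{1,2,\dots\}$ satisfy $$\sum_{k=0}^\infty\beta_k=+\infty,\qquad\sum_{k=0}^\infty\beta_k^2<\infty,\qquad\sum_{k=0}^\infty\frac{\beta_k}{m_k}<\infty.$$ Then any sequence of iterates $(z_k)$ generated by the projected clipped SGD algorithm (described in the context, with this radius $r$, any $z_0\in B_r$ and any clipping parameter $\gamma>0$) converges almost surely to $z_{\bar\mu}$.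
   Context: $\|\cdot\|$ is the Euclidean norm, $B_r$ the closed Euclidean ball of radius $r$ centered at $0$ in $\mathbb R^d$, $P_{B_r}$ the Euclidean projection onto $B_r$, $g^*$ the Fenchel conjugate of $g$, $\partial_z$ the convex subdifferential in the variable $z$; $e^{+\infty}=+\infty$. Sampling schemes. (S1): there is a Borel probability measure $\mu$ on $\mathcal X$ and one can generate fresh collections of i.i.d. samples of prescribed size from $\mu$, (conditionally) independent of the previously generated collections; then $\bar\mu=\mu$. (S2): there is a fixed dataset $\mathcal D=(x_i)_{i=1}^n$ of samples from $\mu$, with empirical measure $\hat\mu_n=\frac1n\sum_{i=1}^n\delta_{x_i}$, and one can generate fresh collections of i.i.d. samples from $\hat\mu_n$ that, conditionally on $\mathcal D$, are independent of the previously generated collections; then $\bar\mu=\hat\mu_n$. Projected clipped SGD. Fix the radius $r$, an initial point $z_0\in B_r$, stepsizes $(\beta_k)$, batch sizes $(m_k)$ and a clipping parameter $\gamma>0$. For $k=0,1,2,\dots$: draw a fresh batch $x_{k_1},\dots,x_{k_{m_k}}$ according to (S1) or (S2); set $g_k=\frac1{m_k}\sum_{i=1}^{m_k}\ell'(x_{k_i},z_k)$, where $\ell'$ is a measurable selection of subgradients, $\ell'(x,z)\in\partial_z\ell(x,z)$ for $x\in\mathcal X$, $z\in B_r$; set $$z_{k+1}=P_{B_r}\Big(z_k-\beta_k\min\Big\{1,\frac{\gamma}{\|g_k\|}\Big\}g_k\Big),$$ with the factor $\min\{1,\gamma/\|g_k\|\}$ read as $1$ when $g_k=0$. *)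

theory Defs
  imports "HOL-Probability.Probability"
begin

section \<open>Convex analysis for extended-real-valued functions\<close>

definition fenchel_conjugate :: "('a::real_inner \<Rightarrow> real) \<Rightarrow> 'a \<Rightarrow> ereal" where
  "fenchel_conjugate g y = (SUP u. ereal (y \<bullet> u - g u))"

definition effective_domain :: "('a \<Rightarrow> ereal) \<Rightarrow> 'a set" where
  "effective_domain f = {z. f z < \<infinity>}"

text \<open>The subdifferential is empty at points where \<open>f\<close> is not finite.\<close>

definition subdifferential :: "('a::real_inner \<Rightarrow> ereal) \<Rightarrow> 'a \<Rightarrow> 'a set" where
  "subdifferential f z =
     {v. \<bar>f z\<bar> \<noteq> \<infinity> \<and> (\<forall>w. f w \<ge> f z + ereal (v \<bullet> (w - z)))}"

definition exp_ereal :: "ereal \<Rightarrow> ereal" where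
  "exp_ereal x = (case x of ereal t \<Rightarrow> ereal (exp t) | PInfty \<Rightarrow> \<infinity> | MInfty \<Rightarrow> 0)"

lemma exp_ereal_simps [simp]:
  "exp_ereal (ereal t) = ereal (exp t)"
  "exp_ereal \<infinity> = \<infinity>"
  "exp_ereal (-\<infinity>) = 0"
  by (simp_all add: exp_ereal_def)

section \<open>The loss and its expectation\<close>

text \<open>As \<open>g\<close> is finite, its conjugate never takes the value \<open>-\<infinity>\<close>,
  so the sum below is never of the form \<open>\<infinity> - \<infinity>\<close>.\<close>

definition loss ::
  "(real ^ 'd \<Rightarrow> real) \<Rightarrow> real ^ 'm ^ 'd \<Rightarrow> real ^ 'd \<Rightarrow> real \<Rightarrow> real ^ 'm \<Rightarrow> real ^ 'd \<Rightarrow> ereal" where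
  "loss g A b \<alpha> x z =
     exp_ereal (ereal \<alpha> * fenchel_conjugate g (- z /\<^sub>R \<alpha>)
                + ereal (- (b \<bullet> z) + (transpose A *v z) \<bullet> x))"

text \<open>The expectation lives in \<open>[0, \<infinity>]\<close>; \<^const>\<open>e2ennreal\<close> only changes the type of
  a nonnegative integrand.\<close>

definition risk :: "'x measure \<Rightarrow> ('x \<Rightarrow> 'z \<Rightarrow> ereal) \<Rightarrow> 'z \<Rightarrow> ennreal" where
  "risk \<mu> l z = (\<integral>\<^sup>+ x. e2ennreal (l x z) \<partial>\<mu>)"

section \<open>Sampling schemes\<close>

definition borel_prob_on :: "'x::topological_space set \<Rightarrow> 'x measure \<Rightarrow> bool" where
  "borel_prob_on X \<mu> \<longleftrightarrow> prob_space \<mu> \<and> sets \<mu> = sets (restrict_space borel X)"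

text \<open>The push-forward of the uniform measure on the indices \<open>0, \<dots>, n - 1\<close>, so repeated
  data points are counted with their multiplicity.\<close>

definition empirical_measure ::
  "'x::topological_space set \<Rightarrow> nat \<Rightarrow> (nat \<Rightarrow> 'x) \<Rightarrow> 'x measure" where
  "empirical_measure X n D = distr (uniform_count_measure {..<n}) (restrict_space borel X) D"

lemma emeasure_empirical_measure:
  assumes n: "n > 0" and D: "\<And>i. i < n \<Longrightarrow> D i \<in> X"
    and B: "B \<in> sets (restrict_space borel X)"
  shows "emeasure (empirical_measure X n D) B
         = (\<Sum>i<n. emeasure (return (restrict_space borel X) (D i)) B) / of_nat n"
proof -
  have meas: "D \<in> measurable (uniform_count_measure {..<n}) (restrict_space borel X)"
    using D by (auto simp: measurable_def space_uniform_count_measure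
        sets_uniform_count_measure space_restrict_space)
  have "emeasure (empirical_measure X n D) B
        = emeasure (uniform_count_measure {..<n}) (D -` B \<inter> {..<n})"
    unfolding empirical_measure_def using B
    by (simp add: emeasure_distr[OF meas] space_uniform_count_measure)
  also have "\<dots> = ennreal (card (D -` B \<inter> {..<n}) / n)"
    using n by (subst emeasure_uniform_count_measure) auto
  also have "\<dots> = of_nat (card (D -` B \<inter> {..<n})) / of_nat n"
    using n by (simp add: divide_ennreal[symmetric] ennreal_of_nat_eq_real_of_nat)
  also have "of_nat (card (D -` B \<inter> {..<n}))
             = (\<Sum>i<n. emeasure (return (restrict_space borel X) (D i)) B)"
    using B by (simp add: indicator_def sum.If_cases Int_def vimage_def conj_commute)
  finally show ?thesis .
qed

text \<open>
  \<open>\<xi> k i\<close> is the \<open>i\<close>-th sample of the \<open>k\<close>-th batch, \<open>i < m k\<close>.  Each batch is i.i.d. with law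
  \<open>\<mu>\<close>, and as a random vector it is independent of all earlier batches taken jointly.  Both
  vectors are indexed by pairs (batch, position) only because \<^const>\<open>prob_space.indep_var\<close>
  needs a common value type.
\<close>

definition samples_at ::
  "(nat \<Rightarrow> nat \<Rightarrow> 'w \<Rightarrow> 'x) \<Rightarrow> (nat \<times> nat) set \<Rightarrow> 'w \<Rightarrow> nat \<times> nat \<Rightarrow> 'x" where
  "samples_at \<xi> J \<omega> = (\<lambda>p\<in>J. \<xi> (fst p) (snd p) \<omega>)"

definition fresh_iid_batches ::
  "'w measure \<Rightarrow> 'x measure \<Rightarrow> (nat \<Rightarrow> nat) \<Rightarrow> (nat \<Rightarrow> nat \<Rightarrow> 'w \<Rightarrow> 'x) \<Rightarrow> bool" where
  "fresh_iid_batches M \<mu> m \<xi> \<longleftrightarrow>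
     (\<forall>k. (\<forall>i<m k. \<xi> k i \<in> measurable M \<mu> \<and> distr M \<mu> (\<xi> k i) = \<mu>)
        \<and> prob_space.indep_vars M (\<lambda>_. \<mu>) (\<xi> k) {..<m k}
        \<and> (let new = {k} \<times> {..<m k}; old = (SIGMA j:{..<k}. {..<m j}) in
             prob_space.indep_var M (PiM new (\<lambda>_. \<mu>)) (samples_at \<xi> new)
                                    (PiM old (\<lambda>_. \<mu>)) (samples_at \<xi> old)))"

definition sampling_S1 ::
  "'w measure \<Rightarrow> 'x::topological_space set \<Rightarrow> (nat \<Rightarrow> nat) \<Rightarrow> (nat \<Rightarrow> nat \<Rightarrow> 'w \<Rightarrow> 'x)
     \<Rightarrow> 'x measure \<Rightarrow> bool" where
  "sampling_S1 M X m \<xi> \<mu>bar \<longleftrightarrow> borel_prob_on X \<mu>bar \<and> fresh_iid_batches M \<mu>bar m \<xi>"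

text \<open>The dataset \<open>D\<close> is fixed, so \<open>M\<close> is the conditional probability given the dataset.  The
  distribution the data were originally drawn from then no longer matters, and every finite
  dataset in \<open>X\<close> is allowed.\<close>

definition sampling_S2 ::
  "'w measure \<Rightarrow> 'x::topological_space set \<Rightarrow> (nat \<Rightarrow> nat) \<Rightarrow> (nat \<Rightarrow> nat \<Rightarrow> 'w \<Rightarrow> 'x)
     \<Rightarrow> 'x measure \<Rightarrow> bool" where
  "sampling_S2 M X m \<xi> \<mu>bar \<longleftrightarrow>
     (\<exists>n D. n > 0 \<and> (\<forall>i<n. D i \<in> X) \<and> \<mu>bar = empirical_measure X n D
        \<and> fresh_iid_batches M \<mu>bar m \<xi>)"

section \<open>Projected clipped SGD\<close>

definition clip_factor :: "real \<Rightarrow> 'a::real_normed_vector \<Rightarrow> real" where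
  "clip_factor \<gamma> v = (if v = 0 then 1 else min 1 (\<gamma> / norm v))"

definition batch_gradient ::
  "('x \<Rightarrow> 'a::real_vector \<Rightarrow> 'a) \<Rightarrow> nat \<Rightarrow> (nat \<Rightarrow> 'x) \<Rightarrow> 'a \<Rightarrow> 'a" where
  "batch_gradient l' n xs z = (1 / real n) *\<^sub>R (\<Sum>i<n. l' (xs i) z)"

primrec clipped_sgd ::
  "('x \<Rightarrow> 'a::euclidean_space \<Rightarrow> 'a) \<Rightarrow> real \<Rightarrow> (nat \<Rightarrow> real) \<Rightarrow> (nat \<Rightarrow> nat) \<Rightarrow> real
     \<Rightarrow> 'a \<Rightarrow> (nat \<Rightarrow> nat \<Rightarrow> 'x) \<Rightarrow> nat \<Rightarrow> 'a" where
  "clipped_sgd l' r step m \<gamma> z0 xs 0 = z0"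
| "clipped_sgd l' r step m \<gamma> z0 xs (Suc k) =
     (let z = clipped_sgd l' r step m \<gamma> z0 xs k;
          v = batch_gradient l' (m k) (xs k) z
      in closest_point (cball 0 r) (z - (step k * clip_factor \<gamma> v) *\<^sub>R v))"

end

theory Submission
  imports Defs
begin

text \<open>
  Smoothness of \<open>g\<close> makes its conjugate strongly convex, and therefore so is the exponent of the
  loss in \<open>z\<close>.  On the compact set \<open>X \<times> cball 0 r\<close> the exponent is bounded, so its exponential, the
  loss, is strongly convex there with a modulus that does not depend on the sample, and its
  subgradients are bounded because the ball lies in the interior of the domain
  (\<open>loss_subgradients_bounded_and_monotone\<close>).  Integrating over the sample and using that \<open>zbar\<close>
  minimizes the risk, the mean gradient \<open>G z\<close> satisfies
  \<open>c * (norm (z - zbar))\<^sup>2 \<le> G z \<bullet> (z - zbar)\<close>.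

  Clipping is the projection onto a ball.  It therefore does not enlarge the distance between \<open>G z\<close>
  and the batch gradient, and it shortens the bounded vector \<open>G z\<close> by a factor bounded away from zero.  Hence, on every single
  outcome, the squared distance \<open>D k\<close> of the iterate to \<open>zbar\<close> satisfies
  \<open>D (k + 1) \<le> D k - p * step k * D k + step k / p * E k + (step k)\<^sup>2 * \<gamma>\<^sup>2\<close>,
  where \<open>E k\<close> is the squared sampling error of batch \<open>k\<close> (\<open>clipped_step_contracts\<close>).

  A batch is independent of the iterate at which its gradient is taken, so the mean of \<open>E k\<close> is
  \<open>O(1 / m k)\<close> (\<open>batch_gradient_mean_sq_error\<close>), and the summability of \<open>step k / m k\<close> makes
  \<open>step k * E k\<close> summable almost surely.  This replaces martingale convergence: only a
  deterministic recursion with summable errors remains, and divergence of the stepsizes drives \<open>D\<close>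
  to zero (\<open>perturbed_contraction_tendsto_0\<close>).
\<close>

section \<open>Smoothness of a function and strong convexity of its conjugate\<close>

text \<open>The one consequence of smoothness that strong convexity of the conjugate rests on.\<close>

lemma symmetric_second_difference_le:
  fixes g :: "'a::real_inner \<Rightarrow> real"
  assumes deriv: "\<And>u. GDERIV g u :> grad u" and lip: "L-lipschitz_on UNIV grad"
  shows "g (u + s) + g (u - s) - 2 * g u \<le> L * (norm s)\<^sup>2"
proof -
  \<comment> \<open>The slope of \<open>q\<close> at \<open>t\<close> compares the gradients at two points \<open>2 t s\<close> apart; the quadratic
    correction is what the Lipschitz bound on that difference integrates to.\<close>
  define q where "q t = g (u + t *\<^sub>R s) + g (u - t *\<^sub>R s) - L * (norm s)\<^sup>2 * t\<^sup>2" for t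
  have "q 1 \<le> q 0"
  proof (rule DERIV_nonpos_imp_nonincreasing[where f = q])
    fix t :: real
    assume t: "0 \<le> t" "t \<le> 1"
    have g': "(g has_derivative (\<lambda>h. h \<bullet> grad v)) (at v)" for v
      using deriv[of v] by (simp add: gderiv_def)
    have "((\<lambda>t. g (u + t *\<^sub>R s)) has_derivative (\<lambda>h. (h *\<^sub>R s) \<bullet> grad (u + t *\<^sub>R s))) (at t)"
      by (rule has_derivative_compose[OF _ g']) (auto intro!: derivative_eq_intros)
    moreover have "((\<lambda>t. g (u - t *\<^sub>R s)) has_derivative (\<lambda>h. (- h *\<^sub>R s) \<bullet> grad (u - t *\<^sub>R s))) (at t)"
      by (rule has_derivative_compose[OF _ g']) (auto intro!: derivative_eq_intros)
    ultimately have
      "((\<lambda>t. g (u + t *\<^sub>R s)) has_real_derivative (s \<bullet> grad (u + t *\<^sub>R s))) (at t)"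
      "((\<lambda>t. g (u - t *\<^sub>R s)) has_real_derivative (- (s \<bullet> grad (u - t *\<^sub>R s)))) (at t)"
      by (auto intro: has_derivative_imp_has_field_derivative simp: mult.commute)
    then have "(q has_real_derivative (s \<bullet> (grad (u + t *\<^sub>R s) - grad (u - t *\<^sub>R s))
          - 2 * L * (norm s)\<^sup>2 * t)) (at t)"
      unfolding q_def by (auto intro!: derivative_eq_intros simp: inner_diff_right)
    moreover have "s \<bullet> (grad (u + t *\<^sub>R s) - grad (u - t *\<^sub>R s)) \<le> 2 * L * (norm s)\<^sup>2 * t"
    proof -
      have "norm (grad (u + t *\<^sub>R s) - grad (u - t *\<^sub>R s)) \<le> L * dist (u + t *\<^sub>R s) (u - t *\<^sub>R s)"
        using lipschitz_onD[OF lip, of "u + t *\<^sub>R s" "u - t *\<^sub>R s"] by (simp add: dist_norm)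
      also have "dist (u + t *\<^sub>R s) (u - t *\<^sub>R s) = 2 * t * norm s"
        using t by (simp add: dist_norm scaleR_2[symmetric])
      finally have "norm s * norm (grad (u + t *\<^sub>R s) - grad (u - t *\<^sub>R s))
          \<le> norm s * (L * (2 * t * norm s))"
        by (intro mult_left_mono) auto
      then show ?thesis
        using norm_cauchy_schwarz[of s "grad (u + t *\<^sub>R s) - grad (u - t *\<^sub>R s)"]
        by (simp add: power2_eq_square mult_ac)
    qed
    ultimately show "\<exists>y. (q has_real_derivative y) (at t) \<and> y \<le> 0"
      by auto
  qed auto
  then show ?thesis
    by (simp add: q_def)
qed

lemma fenchel_conjugate_ge: "ereal (y \<bullet> u - g u) \<le> fenchel_conjugate g y"
  unfolding fenchel_conjugate_def by (rule SUP_upper) simp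

text \<open>Smoothness of \<open>g\<close> dualizes to strong convexity of its conjugate.  The midpoint form suffices
  below: it needs no subgradient of the conjugate and combines directly with the exponential.\<close>

lemma fenchel_conjugate_midpoint_le:
  fixes g :: "'a::real_inner \<Rightarrow> real"
  assumes deriv: "\<And>u. GDERIV g u :> grad u" and lip: "(1 / \<beta>)-lipschitz_on UNIV grad"
    and "\<beta> > 0"
    and y: "fenchel_conjugate g y = ereal a" and y': "fenchel_conjugate g y' = ereal a'"
  shows "fenchel_conjugate g ((1/2) *\<^sub>R (y + y')) \<le> ereal ((a + a') / 2 - \<beta> / 8 * (norm (y - y'))\<^sup>2)"
  unfolding fenchel_conjugate_def
proof (rule SUP_least, unfold ereal_less_eq)
  fix u
  \<comment> \<open>Testing the conjugate at \<open>u + s\<close> for \<open>y\<close> and at \<open>u - s\<close> for \<open>y'\<close> gains \<open>(y - y') \<bullet> s / 2\<close>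
    and loses \<open>(norm s)\<^sup>2 / (2 \<beta>)\<close>; this \<open>s\<close> maximizes the difference.\<close>
  define s where "s = (\<beta> / 2) *\<^sub>R (y - y')"
  have "(1/2) *\<^sub>R (y + y') \<bullet> u - g u
      = (y \<bullet> (u + s) + y' \<bullet> (u - s)) / 2 - g u - ((y - y') \<bullet> s) / 2"
    by (simp add: algebra_simps) argo
  also have "\<dots> = ((y \<bullet> (u + s) - g (u + s)) + (y' \<bullet> (u - s) - g (u - s))) / 2
      + (g (u + s) + g (u - s) - 2 * g u) / 2 - ((y - y') \<bullet> s) / 2"
    by argo
  also have "\<dots> \<le> (a + a') / 2 + (1 / \<beta> * (norm s)\<^sup>2) / 2 - ((y - y') \<bullet> s) / 2"
    using symmetric_second_difference_le[OF deriv lip, of u s]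
      fenchel_conjugate_ge[of y "u + s" g] fenchel_conjugate_ge[of y' "u - s" g]
    unfolding y y' ereal_less_eq by argo
  also have "\<dots> = (a + a') / 2 - \<beta> / 8 * (norm (y - y'))\<^sup>2"
  proof -
    have "(norm s)\<^sup>2 = \<beta>\<^sup>2 / 4 * (norm (y - y'))\<^sup>2"
      "(y - y') \<bullet> s = \<beta> / 2 * (norm (y - y'))\<^sup>2"
      using \<open>\<beta> > 0\<close> unfolding s_def power2_norm_eq_inner inner_scaleR_left inner_scaleR_right
      by (simp_all add: power2_eq_square)
    then show ?thesis
      using \<open>\<beta> > 0\<close> by (simp add: field_simps power2_eq_square)
  qed
  finally show "(1/2) *\<^sub>R (y + y') \<bullet> u - g u \<le> (a + a') / 2 - \<beta> / 8 * (norm (y - y'))\<^sup>2" .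
qed

section \<open>The loss on the domain of the conjugate\<close>

abbreviation (input) conj_domain :: "('a::real_inner \<Rightarrow> real) \<Rightarrow> real \<Rightarrow> 'a set" where
  "conj_domain g \<alpha> \<equiv> effective_domain (\<lambda>z. fenchel_conjugate g (- z /\<^sub>R \<alpha>))"

text \<open>Every fact about its values assumes that \<open>z\<close> lies in \<open>conj_domain g \<alpha>\<close>, so the default value
  \<open>0\<close> of \<^const>\<open>real_of_ereal\<close> at \<open>\<infinity>\<close> carries no meaning.\<close>

definition conj_real :: "('a::real_inner \<Rightarrow> real) \<Rightarrow> real \<Rightarrow> 'a \<Rightarrow> real" where
  "conj_real g \<alpha> z = real_of_ereal (fenchel_conjugate g (- z /\<^sub>R \<alpha>))"

definition log_loss ::
  "(real ^ 'd \<Rightarrow> real) \<Rightarrow> real ^ 'm ^ 'd \<Rightarrow> real ^ 'd \<Rightarrow> real \<Rightarrow> real ^ 'm \<Rightarrow> real ^ 'd \<Rightarrow> real" where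
  "log_loss g A b \<alpha> x z = \<alpha> * conj_real g \<alpha> z - b \<bullet> z + (transpose A *v z) \<bullet> x"

lemma fenchel_conjugate_eq_conj_real:
  assumes "z \<in> conj_domain g \<alpha>"
  shows "fenchel_conjugate g (- z /\<^sub>R \<alpha>) = ereal (conj_real g \<alpha> z)"
  using assms fenchel_conjugate_ge[of "- z /\<^sub>R \<alpha>" 0 g]
  by (cases "fenchel_conjugate g (- z /\<^sub>R \<alpha>)") (auto simp: effective_domain_def conj_real_def)

lemma loss_eq_exp_log_loss:
  assumes "z \<in> conj_domain g \<alpha>"
  shows "loss g A b \<alpha> x z = ereal (exp (log_loss g A b \<alpha> x z))"
  unfolding loss_def fenchel_conjugate_eq_conj_real[OF assms] log_loss_def by simp

lemma conj_real_convex_comb: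
  assumes z: "z \<in> conj_domain g \<alpha>" and w: "w \<in> conj_domain g \<alpha>"
    and st: "0 \<le> s" "0 \<le> t" "s + t = 1"
  shows "s *\<^sub>R z + t *\<^sub>R w \<in> conj_domain g \<alpha>"
    and "conj_real g \<alpha> (s *\<^sub>R z + t *\<^sub>R w) \<le> s * conj_real g \<alpha> z + t * conj_real g \<alpha> w"
proof -
  let ?c = "s * conj_real g \<alpha> z + t * conj_real g \<alpha> w" and ?y = "s *\<^sub>R z + t *\<^sub>R w"
  have le: "fenchel_conjugate g (- ?y /\<^sub>R \<alpha>) \<le> ereal ?c"
    unfolding fenchel_conjugate_def
  proof (rule SUP_least, subst ereal_less_eq)
    fix u
    have "(- ?y /\<^sub>R \<alpha>) \<bullet> u - g u
        = s * ((- z /\<^sub>R \<alpha>) \<bullet> u) + t * ((- w /\<^sub>R \<alpha>) \<bullet> u) - (s + t) * g u"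
      using st by (simp add: algebra_simps)
    also have "\<dots> = s * ((- z /\<^sub>R \<alpha>) \<bullet> u - g u) + t * ((- w /\<^sub>R \<alpha>) \<bullet> u - g u)"
      by (simp add: algebra_simps)
    also have "\<dots> \<le> ?c"
      using fenchel_conjugate_ge[of "- z /\<^sub>R \<alpha>" u g] fenchel_conjugate_ge[of "- w /\<^sub>R \<alpha>" u g] st
      by (intro add_mono mult_left_mono)
        (simp_all only: fenchel_conjugate_eq_conj_real[OF z] fenchel_conjugate_eq_conj_real[OF w] ereal_less_eq)
    finally show "(- ?y /\<^sub>R \<alpha>) \<bullet> u - g u \<le> ?c" .
  qed
  then show *: "?y \<in> conj_domain g \<alpha>"
    unfolding effective_domain_def mem_Collect_eq by (rule le_less_trans) simp
  show "conj_real g \<alpha> ?y \<le> ?c"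
    using le unfolding fenchel_conjugate_eq_conj_real[OF *] by simp
qed

text \<open>A finite convex function on an open subset of a Euclidean space is continuous; the remaining
  terms are bilinear.  Joint continuity yields bounds uniform in the sample \<open>x\<close>.\<close>

lemma continuous_on_log_loss:
  "continuous_on (UNIV \<times> interior (conj_domain g \<alpha>)) (\<lambda>(x, z). log_loss g A b \<alpha> x z)"
proof -
  let ?U = "interior (conj_domain g \<alpha>)"
  have "convex (conj_domain g \<alpha>)"
    by (rule convexI) (rule conj_real_convex_comb(1))
  then have "convex_on ?U (conj_real g \<alpha>)"
    using interior_subset[of "conj_domain g \<alpha>"]
    by (intro convex_onI convex_interior) (auto intro!: conj_real_convex_comb(2))
  then have "continuous_on ?U (conj_real g \<alpha>)"
    by (intro convex_on_continuous) simp_all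
  then have "continuous_on (UNIV \<times> ?U) (\<lambda>p. conj_real g \<alpha> (snd p))"
    by (rule continuous_on_compose2) (auto intro: continuous_intros)
  moreover have "continuous_on (UNIV \<times> ?U) (\<lambda>p. transpose A *v snd p)"
    by (intro continuous_on_compose2[OF matrix_vector_mult_linear_continuous_on[of UNIV]] continuous_intros) auto
  ultimately show ?thesis
    unfolding log_loss_def case_prod_unfold by (intro continuous_intros)
qed

lemma log_loss_midpoint_le:
  assumes deriv: "\<And>u. GDERIV g u :> grad u" and lip: "(1 / \<beta>)-lipschitz_on UNIV grad"
    and "0 < \<beta>" "0 < \<alpha>"
    and z: "z \<in> conj_domain g \<alpha>" and w: "w \<in> conj_domain g \<alpha>"
  shows "log_loss g A b \<alpha> x ((1/2) *\<^sub>R (z + w))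
    \<le> (log_loss g A b \<alpha> x z + log_loss g A b \<alpha> x w) / 2 - \<beta> / (8 * \<alpha>) * (norm (z - w))\<^sup>2"
proof -
  let ?y = "(1/2) *\<^sub>R (z + w)"
  have y: "?y \<in> conj_domain g \<alpha>"
    using conj_real_convex_comb(1)[OF z w, of "1/2" "1/2"] by (simp add: scaleR_add_right)
  have "(1/2) *\<^sub>R (- z /\<^sub>R \<alpha> + - w /\<^sub>R \<alpha>) = - ?y /\<^sub>R \<alpha>"
    by (simp add: algebra_simps)
  moreover have "norm (- z /\<^sub>R \<alpha> - - w /\<^sub>R \<alpha>) = norm (z - w) / \<alpha>"
  proof -
    have "- z /\<^sub>R \<alpha> - - w /\<^sub>R \<alpha> = - ((z - w) /\<^sub>R \<alpha>)"
      by (simp add: algebra_simps)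
    then show ?thesis using \<open>0 < \<alpha>\<close> by (simp only: norm_minus_cancel norm_scaleR) (simp add: field_simps)
  qed
  ultimately have "conj_real g \<alpha> ?y
      \<le> (conj_real g \<alpha> z + conj_real g \<alpha> w) / 2 - \<beta> / 8 * (norm (z - w) / \<alpha>)\<^sup>2"
    using fenchel_conjugate_midpoint_le[OF deriv lip \<open>0 < \<beta>\<close>
        fenchel_conjugate_eq_conj_real[OF z] fenchel_conjugate_eq_conj_real[OF w]]
    by (simp only: fenchel_conjugate_eq_conj_real[OF y] ereal_less_eq)
  then have "\<alpha> * conj_real g \<alpha> ?y
      \<le> \<alpha> * ((conj_real g \<alpha> z + conj_real g \<alpha> w) / 2 - \<beta> / 8 * (norm (z - w) / \<alpha>)\<^sup>2)"
    using \<open>0 < \<alpha>\<close> by (intro mult_left_mono) auto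
  also have "\<dots> = (\<alpha> * conj_real g \<alpha> z + \<alpha> * conj_real g \<alpha> w) / 2 - \<beta> / (8 * \<alpha>) * (norm (z - w))\<^sup>2"
    using \<open>0 < \<alpha>\<close> by (simp add: field_simps power2_eq_square)
  finally show ?thesis
    by (simp add: log_loss_def diff_divide_distrib inner_add_right inner_add_left matrix_vector_right_distrib
        matrix_vector_mult_scaleR add_divide_distrib)
qed

text \<open>Inside the domain the extended-valued risk is an ordinary integral, so that minimality of the
  risk can be combined with integrated real inequalities.\<close>

lemma risk_loss_eq:
  assumes "borel_prob_on X \<mu>" "compact X" and z: "z \<in> interior (conj_domain g \<alpha>)"
  shows "integrable \<mu> (\<lambda>x. exp (log_loss g A b \<alpha> x z))"
    and "risk \<mu> (loss g A b \<alpha>) z = ennreal (\<integral>x. exp (log_loss g A b \<alpha> x z) \<partial>\<mu>)"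
proof -
  interpret prob_space \<mu> using assms by (simp add: borel_prob_on_def)
  have sets: "sets \<mu> = sets (restrict_space borel X)" using assms by (simp add: borel_prob_on_def)
  then have space: "space \<mu> = X" by (simp add: sets_eq_imp_space_eq space_restrict_space)
  have cont: "continuous_on X (\<lambda>x. exp (log_loss g A b \<alpha> x z))"
    unfolding log_loss_def by (intro continuous_intros)
  then have meas: "(\<lambda>x. exp (log_loss g A b \<alpha> x z)) \<in> borel_measurable \<mu>"
    using borel_measurable_continuous_on_restrict measurable_cong_sets[OF sets refl] by blast
  obtain B where "\<And>x. x \<in> X \<Longrightarrow> norm (exp (log_loss g A b \<alpha> x z)) \<le> B"
    using compact_imp_bounded[OF compact_continuous_image[OF cont \<open>compact X\<close>]]
    by (auto simp: bounded_iff)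
  with meas show int: "integrable \<mu> (\<lambda>x. exp (log_loss g A b \<alpha> x z))"
    by (intro integrable_const_bound[of _ B]) (auto simp: space)
  have "z \<in> conj_domain g \<alpha>" using z interior_subset by blast
  then have "risk \<mu> (loss g A b \<alpha>) z = (\<integral>\<^sup>+x. ennreal (exp (log_loss g A b \<alpha> x z)) \<partial>\<mu>)"
    by (simp add: risk_def loss_eq_exp_log_loss e2ennreal_ereal)
  also have "\<dots> = ennreal (\<integral>x. exp (log_loss g A b \<alpha> x z) \<partial>\<mu>)"
    using int by (rule nn_integral_eq_integral) simp
  finally show "risk \<mu> (loss g A b \<alpha>) z = ennreal (\<integral>x. exp (log_loss g A b \<alpha> x z) \<partial>\<mu>)" .
qed

section \<open>Subgradients of the loss\<close>

text \<open>The exponential carries a midpoint gain \<open>s\<close> in the exponent over to a gain proportional to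
  \<open>s\<close>, with a factor that stays away from zero wherever the exponent is bounded below.\<close>

lemma exp_midpoint_gain:
  fixes s :: real
  assumes "p \<le> (a + a') / 2 - s" "l \<le> exp p" "0 \<le> s"
  shows "exp p \<le> (exp a + exp a') / 2 - l * s"
proof -
  have "exp p + l * s \<le> exp p * (1 + s)"
    using mult_right_mono[OF assms(2,3)] by (simp add: algebra_simps)
  also have "\<dots> \<le> exp p * exp s"
    using exp_ge_add_one_self[of s] by (intro mult_left_mono) auto
  also have "\<dots> \<le> exp ((a + a') / 2)"
    unfolding exp_add[symmetric] exp_le_cancel_iff using assms(1) by argo
  also have "\<dots> = exp (a / 2) * exp (a' / 2)"
    by (simp add: add_divide_distrib flip: exp_add)
  \<comment> \<open>Midpoint convexity of \<open>exp\<close>, as the arithmetic-geometric mean inequality.\<close>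
  also have "\<dots> \<le> ((exp (a / 2))\<^sup>2 + (exp (a' / 2))\<^sup>2) / 2"
    using sum_squares_bound[of "exp (a / 2)" "exp (a' / 2)"] by simp
  also have "\<dots> = (exp a + exp a') / 2"
    by (simp flip: exp_double)
  finally show ?thesis by argo
qed

text \<open>Evaluating the subgradient inequality at the midpoint, where strong convexity makes the function
  small, gives strong monotonicity without any limit along the segment.\<close>

lemma subgradient_inner_ge:
  assumes v: "v \<in> subdifferential f z" and f: "f z = ereal p" "f w = ereal q"
    and mid: "f ((1/2) *\<^sub>R (z + w)) \<le> ereal ((p + q) / 2 - \<kappa>)"
  shows "p - q + 2 * \<kappa> \<le> v \<bullet> (z - w)"
proof -
  have *: "(1/2) *\<^sub>R (z + w) - z = - ((1/2) *\<^sub>R (z - w))"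
    by (simp add: algebra_simps flip: scaleR_add_left)
  have "ereal p + ereal (v \<bullet> ((1/2) *\<^sub>R (z + w) - z)) \<le> f ((1/2) *\<^sub>R (z + w))"
    using v f by (auto simp: subdifferential_def)
  also note mid
  finally have "p - (v \<bullet> (z - w)) / 2 \<le> (p + q) / 2 - \<kappa>" unfolding * by simp
  then show ?thesis by argo
qed

text \<open>A subgradient \<open>v\<close> forces the function to rise by at least \<open>e * norm v\<close> over a step of length \<open>e\<close>
  in the direction of \<open>v\<close>, and a function with values in \<open>[0, c]\<close> rises by at most \<open>c\<close>.\<close>

lemma subgradient_norm_le:
  assumes v: "v \<in> subdifferential f z" and "0 < e"
    and f: "\<And>w. w \<in> cball z e \<Longrightarrow> 0 \<le> f w \<and> f w \<le> ereal c"
  shows "norm v \<le> c / e"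
proof (cases "v = 0")
  case True
  have "0 \<le> c" using f[of z] \<open>0 < e\<close> by (metis centre_in_cball ereal_less_eq(5) less_imp_le order_trans)
  with True \<open>0 < e\<close> show ?thesis by simp
next
  case False
  define w where "w = z + (e / norm v) *\<^sub>R v"
  have w: "w \<in> cball z e" "v \<bullet> (w - z) = e * norm v"
    using False \<open>0 < e\<close> by (simp_all add: w_def dist_norm field_simps power2_norm_eq_inner[symmetric] power2_eq_square)
  have "ereal (e * norm v) \<le> f z + ereal (v \<bullet> (w - z))"
    using f[of z] \<open>0 < e\<close> w(2) by (simp add: add_increasing)
  also have "\<dots> \<le> f w" using v by (simp add: subdifferential_def)
  also have "\<dots> \<le> ereal c" using f w(1) by simp
  finally show ?thesis using \<open>0 < e\<close> by (simp add: field_simps)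
qed

text \<open>Compactness of \<open>X\<close> and of a neighbourhood of the ball makes both constants uniform in the
  sample: \<open>log_loss\<close> stays in some \<open>[- C, C]\<close> there, so the loss lies between \<open>exp (- C)\<close>, which
  controls strong convexity, and \<open>exp C\<close>, which controls the subgradients.\<close>

lemma loss_subgradients_bounded_and_monotone:
  fixes X :: "(real ^ 'm) set" and A :: "real ^ 'm ^ 'd" and b :: "real ^ 'd"
  assumes X: "compact X" and pos: "0 < \<alpha>" "0 < \<beta>" "0 < r"
    and deriv: "\<And>u. GDERIV g u :> grad u" and lip: "(1 / \<beta>)-lipschitz_on UNIV grad"
    and dom: "cball 0 r \<subseteq> interior (conj_domain g \<alpha>)"
  obtains L c where "0 < L" "0 < c"
    "\<And>x z v. x \<in> X \<Longrightarrow> z \<in> cball 0 r \<Longrightarrow> v \<in> subdifferential (loss g A b \<alpha> x) z \<Longrightarrow> norm v \<le> L"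
    "\<And>x z w v. x \<in> X \<Longrightarrow> z \<in> cball 0 r \<Longrightarrow> w \<in> cball 0 r \<Longrightarrow> v \<in> subdifferential (loss g A b \<alpha> x) z
      \<Longrightarrow> exp (log_loss g A b \<alpha> x z) - exp (log_loss g A b \<alpha> x w) + c * (norm (z - w))\<^sup>2 \<le> v \<bullet> (z - w)"
proof -
  let ?F = "log_loss g A b \<alpha>"
  obtain e where e: "0 < e" "(\<Union>z\<in>cball 0 r. cball z e) \<subseteq> interior (conj_domain g \<alpha>)"
    using compact_subset_open_imp_cball_epsilon_subset[OF compact_cball open_interior dom] by blast
  \<comment> \<open>Subgradients on the ball are controlled by values of the loss on a slightly larger set, which
    must still be compact and inside the domain.\<close>
  define K where "K = {z + u |z u. z \<in> cball (0 :: real ^ 'd) r \<and> u \<in> cball 0 e}"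
  have K_cball: "w \<in> K" if "z \<in> cball 0 r" "w \<in> cball z e" for z w
  proof -
    have "w = z + (w - z)" "w - z \<in> cball 0 e"
      using that(2) by (auto simp: dist_norm norm_minus_commute)
    with that(1) show ?thesis unfolding K_def by blast
  qed
  have K_dom: "K \<subseteq> interior (conj_domain g \<alpha>)"
  proof
    fix w assume "w \<in> K"
    then obtain z u where "w = z + u" "z \<in> cball 0 r" "u \<in> cball 0 e" unfolding K_def by blast
    then have "w \<in> cball z e" by (simp add: dist_norm)
    then show "w \<in> interior (conj_domain g \<alpha>)" using e(2) \<open>z \<in> cball 0 r\<close> by blast
  qed
  have K: "z \<in> K \<Longrightarrow> z \<in> conj_domain g \<alpha>" for z using K_dom interior_subset by blast
  have ball_K: "z \<in> K" if "z \<in> cball 0 r" for z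
    using K_cball[OF that, of z] e by simp
  have "compact K" unfolding K_def by (intro compact_sums compact_cball)
  then have "compact ((\<lambda>(x, z). ?F x z) ` (X \<times> K))"
    using K_dom by (intro compact_continuous_image compact_Times X
        continuous_on_subset[OF continuous_on_log_loss]) auto
  then obtain C where C: "\<And>x z. x \<in> X \<Longrightarrow> z \<in> K \<Longrightarrow> \<bar>?F x z\<bar> \<le> C"
    by (force dest!: compact_imp_bounded simp: bounded_iff)
  show thesis
  proof (rule that)
    show "0 < exp C / e" "0 < exp (- C) * (\<beta> / (4 * \<alpha>))"
      using e pos by simp_all
    fix x z v
    assume x: "x \<in> X" and z: "z \<in> cball 0 r" and v: "v \<in> subdifferential (loss g A b \<alpha> x) z"
    show "norm v \<le> exp C / e"
    proof (rule subgradient_norm_le[OF v e(1)])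
      fix w assume "w \<in> cball z e"
      then have w: "w \<in> K" by (rule K_cball[OF z])
      show "0 \<le> loss g A b \<alpha> x w \<and> loss g A b \<alpha> x w \<le> ereal (exp C)"
        using C[OF x w] by (simp add: loss_eq_exp_log_loss[OF K[OF w]])
    qed
    fix w :: "real ^ 'd" assume w: "w \<in> cball 0 r"
    let ?y = "(1/2) *\<^sub>R (z + w)" and ?s = "\<beta> / (8 * \<alpha>) * (norm (z - w))\<^sup>2"
    have y: "?y \<in> K"
      using convexD[OF convex_cball z w, of "1/2" "1/2"] by (intro ball_K) (simp add: scaleR_add_right)
    have "exp (?F x ?y) \<le> (exp (?F x z) + exp (?F x w)) / 2 - exp (- C) * ?s"
      using C[OF x y] pos K[OF ball_K[OF z]] K[OF ball_K[OF w]]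
      by (intro exp_midpoint_gain log_loss_midpoint_le[OF deriv lip]) auto
    then have "exp (?F x z) - exp (?F x w) + 2 * (exp (- C) * ?s) \<le> v \<bullet> (z - w)"
      unfolding ereal_less_eq(3)[symmetric, of "exp (?F x ?y)"]
      by (intro subgradient_inner_ge[OF v])
        (simp_all only: loss_eq_exp_log_loss[OF K] ball_K[OF z] ball_K[OF w] y)
    then show "exp (?F x z) - exp (?F x w) + exp (- C) * (\<beta> / (4 * \<alpha>)) * (norm (z - w))\<^sup>2 \<le> v \<bullet> (z - w)"
      by (simp add: mult_ac)
  qed
qed

section \<open>One clipped and projected step\<close>

text \<open>Clipping inherits 1-Lipschitz continuity from projections: replacing the exact gradient by a
  sampled one perturbs the clipped direction by no more than the sampling error, so the bias that
  clipping introduces needs no separate estimate.\<close>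

lemma clip_eq_closest_point:
  fixes v :: "'a::euclidean_space"
  assumes "\<gamma> > 0"
  shows "clip_factor \<gamma> v *\<^sub>R v = closest_point (cball 0 \<gamma>) v"
proof (rule closest_point_unique)
  show "clip_factor \<gamma> v *\<^sub>R v \<in> cball 0 \<gamma>"
    using assms by (auto simp: clip_factor_def min_def field_simps)
  show "\<forall>w\<in>cball 0 \<gamma>. dist v (clip_factor \<gamma> v *\<^sub>R v) \<le> dist v w"
  proof
    fix w :: 'a assume w: "w \<in> cball 0 \<gamma>"
    show "dist v (clip_factor \<gamma> v *\<^sub>R v) \<le> dist v w"
    proof (cases "norm v \<le> \<gamma>")
      case True
      then have "clip_factor \<gamma> v = 1"
        by (auto simp: clip_factor_def min_def field_simps)
      then show ?thesis by simp
    next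
      case False
      then have v: "clip_factor \<gamma> v = \<gamma> / norm v" "norm v > \<gamma>"
        using assms by (auto simp: clip_factor_def min_def field_simps)
      have "v - clip_factor \<gamma> v *\<^sub>R v = (1 - \<gamma> / norm v) *\<^sub>R v"
        by (simp add: v algebra_simps)
      then have "dist v (clip_factor \<gamma> v *\<^sub>R v) = \<bar>1 - \<gamma> / norm v\<bar> * norm v"
        by (simp add: dist_norm)
      also have "\<dots> = norm v - \<gamma>"
        using v(2) assms by (auto simp: abs_if field_simps)
      also have "\<dots> \<le> dist v w"
        using w norm_triangle_ineq2[of v w] by (simp add: dist_norm)
      finally show ?thesis .
    qed
  qed
qed auto

lemma clip_factor_ge:
  assumes "\<gamma> > 0" "norm v \<le> L" "L > 0"
  shows "min 1 (\<gamma> / L) \<le> clip_factor \<gamma> v"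
  using assms by (auto simp: clip_factor_def intro!: min.coboundedI2 divide_left_mono)

text \<open>The clipped exact direction is a positive multiple of \<open>G\<close>, and the factor is at least
  \<open>min 1 (\<gamma> / L)\<close>, so it inherits the strong monotonicity of \<open>G\<close>.  The sampled direction differs
  from it by at most \<open>norm (v - G)\<close> and has norm at most \<open>\<gamma>\<close>.  The resulting inequality holds for
  each outcome, without any conditional expectation, and the error enters squared.\<close>

lemma clipped_step_contracts:
  fixes z zs v G :: "'a::euclidean_space"
  assumes "0 \<le> r" "norm zs \<le> r" "0 < \<gamma>" "0 \<le> s" and L: "0 < L" "norm G \<le> L"
    and c: "0 < c" "c * (norm (z - zs))\<^sup>2 \<le> G \<bullet> (z - zs)"
  defines "p \<equiv> min 1 (\<gamma> / L) * c"
  shows "(norm (closest_point (cball 0 r) (z - (s * clip_factor \<gamma> v) *\<^sub>R v) - zs))\<^sup>2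
    \<le> (norm (z - zs))\<^sup>2 - p * s * (norm (z - zs))\<^sup>2 + s / p * (norm (v - G))\<^sup>2 + s\<^sup>2 * \<gamma>\<^sup>2"
proof -
  define w where "w = z - zs"
  define d where "d = clip_factor \<gamma> v *\<^sub>R v"
  define e where "e = clip_factor \<gamma> G *\<^sub>R G"
  define n where "n = norm (v - G)"
  have p: "p > 0" using assms by (simp add: p_def)
  have d_le: "norm d \<le> \<gamma>"
    using clip_eq_closest_point[OF \<open>0 < \<gamma>\<close>, of v] closest_point_in_set[of "cball 0 \<gamma>" v] \<open>0 < \<gamma>\<close>
    by (auto simp: d_def)
  have de: "norm (e - d) \<le> n"
    using closest_point_lipschitz[of "cball 0 \<gamma>" G v] \<open>0 < \<gamma>\<close>
    by (auto simp: d_def e_def n_def clip_eq_closest_point dist_norm norm_minus_commute)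
  have "p * (norm w)\<^sup>2 \<le> clip_factor \<gamma> G * (c * (norm w)\<^sup>2)"
    using mult_right_mono[OF clip_factor_ge[OF \<open>0 < \<gamma>\<close> L(2,1)], of "c * (norm w)\<^sup>2"] c(1)
    by (simp add: p_def mult_ac)
  also have "\<dots> \<le> clip_factor \<gamma> G * (G \<bullet> w)"
    using c(2) \<open>0 < \<gamma>\<close> by (intro mult_left_mono) (auto simp: w_def clip_factor_def)
  also have "\<dots> = e \<bullet> w" by (simp add: e_def)
  also have "e \<bullet> w \<le> d \<bullet> w + n * norm w"
  proof -
    have "(e - d) \<bullet> w \<le> norm (e - d) * norm w" by (rule norm_cauchy_schwarz)
    also have "\<dots> \<le> n * norm w" using de by (intro mult_right_mono) auto
    finally show ?thesis by (simp add: inner_diff_left)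
  qed
  finally have 1: "p * (norm w)\<^sup>2 - n * norm w \<le> d \<bullet> w" by simp
  \<comment> \<open>Young's inequality with weight \<open>p\<close>: half of the drift absorbs the term linear in the noise.\<close>
  have "0 \<le> (p * norm w - n)\<^sup>2 / p" using p by simp
  also have "\<dots> = p * (norm w)\<^sup>2 - 2 * (n * norm w) + n\<^sup>2 / p"
    using p by (simp add: field_simps power2_eq_square)
  finally have 2: "p * (norm w)\<^sup>2 - n\<^sup>2 / p \<le> 2 * (d \<bullet> w)" using 1 by argo
  have "closest_point (cball 0 r) zs = zs"
    using assms by (intro closest_point_self) simp
  then have "norm (closest_point (cball 0 r) (z - s *\<^sub>R d) - zs) \<le> norm (w - s *\<^sub>R d)"
    using closest_point_lipschitz[of "cball 0 r" "z - s *\<^sub>R d" zs] \<open>0 \<le> r\<close>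
    by (auto simp: dist_norm w_def algebra_simps)
  then have "(norm (closest_point (cball 0 r) (z - s *\<^sub>R d) - zs))\<^sup>2 \<le> (norm (w - s *\<^sub>R d))\<^sup>2"
    by (rule power_mono) simp
  also have "\<dots> = (norm w)\<^sup>2 - s * (2 * (d \<bullet> w)) + s\<^sup>2 * (norm d)\<^sup>2"
    unfolding power2_norm_eq_inner by (simp add: algebra_simps inner_commute power2_eq_square)
  also have "\<dots> \<le> (norm w)\<^sup>2 - s * (p * (norm w)\<^sup>2 - n\<^sup>2 / p) + s\<^sup>2 * \<gamma>\<^sup>2"
    using 2 d_le \<open>0 \<le> s\<close> by (intro add_mono diff_mono mult_left_mono power_mono) auto
  also have "\<dots> = (norm w)\<^sup>2 - p * s * (norm w)\<^sup>2 + s / p * n\<^sup>2 + s\<^sup>2 * \<gamma>\<^sup>2"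
    by (simp add: algebra_simps)
  finally show ?thesis by (simp add: d_def w_def n_def)
qed

section \<open>Contractions with divergent total rate and summable errors\<close>

text \<open>A deterministic counterpart of the Robbins-Siegmund theorem.\<close>

lemma perturbed_contraction_tendsto_0:
  fixes D a e :: "nat \<Rightarrow> real"
  assumes D: "\<And>k. 0 \<le> D k" and a: "\<And>k. 0 \<le> a k" and e: "\<And>k. 0 \<le> e k" "summable e"
    and div: "filterlim (\<lambda>n. \<Sum>k<n. a k) at_top sequentially"
    and rec: "\<And>k. D (Suc k) \<le> D k - a k * D k + e k"
  shows "D \<longlonglongrightarrow> 0"
proof -
  \<comment> \<open>Once the accumulated errors are subtracted, \<open>D\<close> is decreasing, hence convergent.\<close>
  define U where "U n = D n - (\<Sum>k<n. e k)" for n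
  have "decseq U"
  proof (rule decseq_SucI)
    fix n show "U (Suc n) \<le> U n"
      using rec[of n] mult_nonneg_nonneg[OF a[of n] D[of n]] by (simp add: U_def)
  qed
  have "- suminf e \<le> U n" for n
    using D[of n] sum_le_suminf[OF e(2), of "{..<n}"] e(1) by (simp add: U_def)
  with \<open>decseq U\<close> obtain l where "U \<longlonglongrightarrow> l"
    by (metis decseq_convergent)
  then have "(\<lambda>n. U n + (\<Sum>k<n. e k)) \<longlonglongrightarrow> l + suminf e"
    by (intro tendsto_add summable_LIMSEQ e)
  then have lim: "D \<longlonglongrightarrow> l + suminf e"
    by (simp add: U_def)
  have sum_le: "(\<Sum>k<n. a k * D k) \<le> D 0 + suminf e" for n
  proof -
    have "(\<Sum>k<n. a k * D k) \<le> D 0 - D n + (\<Sum>k<n. e k)"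
    proof (induction n)
      case (Suc n) then show ?case using rec[of n] by simp
    qed simp
    then show ?thesis
      using D[of n] sum_le_suminf[OF e(2), of "{..<n}"] e(1) by simp
  qed
  \<comment> \<open>A positive limit would keep \<open>D\<close> above some \<open>h > 0\<close>, so the bounded sums of \<open>a k * D k\<close>
    would bound the sums of \<open>a k\<close>.\<close>
  have "l + suminf e = 0"
  proof (rule ccontr)
    define h where "h = (l + suminf e) / 2"
    assume "l + suminf e \<noteq> 0"
    moreover have "0 \<le> l + suminf e" using lim D by (intro LIMSEQ_le_const) auto
    ultimately have h: "0 < h" "h < l + suminf e" by (auto simp: h_def)
    then have "eventually (\<lambda>n. h < D n) sequentially"
      using lim by (intro order_tendstoD(1))
    then obtain N where N: "\<And>n. n \<ge> N \<Longrightarrow> h < D n"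
      unfolding eventually_sequentially by blast
    have "(\<Sum>k<n. a k) \<le> (\<Sum>k<N. a k) + (D 0 + suminf e) / h" for n
    proof -
      have "a k \<le> (if k < N then a k else 0) + a k * D k / h" for k
        using N[of k] h a[of k] D[of k]
        by (cases "k < N") (auto simp: field_simps intro!: mult_right_mono)
      then have "(\<Sum>k<n. a k) \<le> (\<Sum>k<n. (if k < N then a k else 0) + a k * D k / h)"
        by (rule sum_mono)
      also have "\<dots> = (\<Sum>k<n. if k < N then a k else 0) + (\<Sum>k<n. a k * D k) / h"
        by (simp add: sum.distrib sum_divide_distrib)
      also have "(\<Sum>k<n. if k < N then a k else 0) \<le> (\<Sum>k<N. a k)"
        unfolding sum.inter_filter[OF finite_lessThan, symmetric]
        using a by (intro sum_mono2) auto
      also have "(\<Sum>k<n. a k * D k) / h \<le> (D 0 + suminf e) / h"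
        using sum_le[of n] h by (intro divide_right_mono) auto
      finally show ?thesis by simp
    qed
    moreover have "\<exists>n. (\<Sum>k<N. a k) + (D 0 + suminf e) / h < (\<Sum>k<n. a k)"
      using div unfolding filterlim_at_top_dense eventually_sequentially by blast
    ultimately show False by (meson not_le)
  qed
  with lim show ?thesis by simp
qed

section \<open>Sampling error of a batch gradient\<close>

lemma borel_prob_on_empirical_measure:
  assumes "n > 0" "\<And>i. i < n \<Longrightarrow> D i \<in> X"
  shows "borel_prob_on X (empirical_measure X n D)"
proof -
  interpret prob_space "uniform_count_measure {..<n}"
    using assms by (intro prob_space_uniform_count_measure) auto
  have "D \<in> measurable (uniform_count_measure {..<n}) (restrict_space borel X)"
    using assms by (auto simp: measurable_def space_uniform_count_measure
        sets_uniform_count_measure space_restrict_space)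
  then show ?thesis
    by (simp add: borel_prob_on_def empirical_measure_def prob_space_distr)
qed

text \<open>The variance of a mean of \<open>n\<close> independent vectors is \<open>1 / n\<close> times the variance of one of
  them: after centring, the mixed inner products integrate to zero.\<close>

lemma (in prob_space) nn_integral_norm_mean_sq_le:
  fixes f :: "'x \<Rightarrow> 'b::euclidean_space"
  assumes indep: "indep_vars (\<lambda>_. N) \<xi> {..<n}"
    and law: "\<And>i. i < n \<Longrightarrow> distr M N (\<xi> i) = N"
    and f [measurable]: "f \<in> borel_measurable N" and L: "\<And>x. x \<in> space N \<Longrightarrow> norm (f x) \<le> L"
    and "n \<ge> 1"
  shows "(\<integral>\<^sup>+\<omega>. ennreal ((norm ((1 / real n) *\<^sub>R (\<Sum>i<n. f (\<xi> i \<omega>)) - (\<integral>x. f x \<partial>N)))\<^sup>2) \<partial>M)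
    \<le> ennreal (L\<^sup>2 / real n)"
proof -
  have \<xi> [measurable]: "\<xi> i \<in> measurable M N" if "i < n" for i
    using indep that by (auto simp: indep_vars_def)
  interpret N: prob_space N
    using prob_space_distr[OF \<xi>[of 0]] law[of 0] \<open>n \<ge> 1\<close> by auto
  define G where "G = (\<integral>x. f x \<partial>N)"
  define Y where "Y x = f x - G" for x
  have Y_meas [measurable]: "Y \<in> borel_measurable N" by (simp add: Y_def[abs_def])
  have f_int: "integrable N f"
    using L by (intro N.integrable_const_bound[of _ L]) auto
  have Y_bound: "norm (Y x) \<le> L + norm G" if "x \<in> space N" for x
    using L[OF that] norm_triangle_ineq4[of "f x" G] by (simp add: Y_def)
  have in_space: "\<xi> i \<omega> \<in> space N" if "i < n" "\<omega> \<in> space M" for i \<omega>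
    using measurable_space[OF \<xi>[OF that(1)] that(2)] .
  have coord_int: "integrable N (\<lambda>x. Y x \<bullet> b)" for b
    using f_int by (simp add: Y_def)
  have coord_mean: "(\<integral>x. Y x \<bullet> b \<partial>N) = 0" for b
    using f_int by (simp add: Y_def G_def N.prob_space)
  have transfer: "(\<integral>\<omega>. h (\<xi> i \<omega>) \<partial>M) = (\<integral>x. h x \<partial>N)"
    if "i < n" "h \<in> borel_measurable N" for i and h :: "'x \<Rightarrow> real"
    using integral_distr[OF \<xi>[OF that(1)] that(2)] law[OF that(1)] by simp
  have transfer_int: "integrable M (\<lambda>\<omega>. h (\<xi> i \<omega>))"
    if "i < n" "integrable N h" for i and h :: "'x \<Rightarrow> real"
    using integrable_distr[OF \<xi>[OF that(1)], of h] law[OF that(1)] that(2) by simp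
  have YY_int: "integrable M (\<lambda>\<omega>. Y (\<xi> i \<omega>) \<bullet> Y (\<xi> j \<omega>))" if "i < n" "j < n" for i j
  proof (rule integrable_const_bound[of _ "(L + norm G) * (L + norm G)"])
    show "AE \<omega> in M. norm (Y (\<xi> i \<omega>) \<bullet> Y (\<xi> j \<omega>)) \<le> (L + norm G) * (L + norm G)"
    proof (rule AE_I2)
      fix \<omega> assume \<omega>: "\<omega> \<in> space M"
      have "norm (Y (\<xi> i \<omega>) \<bullet> Y (\<xi> j \<omega>)) \<le> norm (Y (\<xi> i \<omega>)) * norm (Y (\<xi> j \<omega>))"
        by (simp add: Cauchy_Schwarz_ineq2)
      also have "\<dots> \<le> (L + norm G) * (L + norm G)"
        using Y_bound[OF in_space[OF that(1) \<omega>]] Y_bound[OF in_space[OF that(2) \<omega>]]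
        by (intro mult_mono) (auto intro: order_trans[OF norm_ge_zero])
      finally show "norm (Y (\<xi> i \<omega>) \<bullet> Y (\<xi> j \<omega>)) \<le> (L + norm G) * (L + norm G)" .
    qed
  qed (use that in measurable)
  have cross: "(\<integral>\<omega>. Y (\<xi> i \<omega>) \<bullet> Y (\<xi> j \<omega>) \<partial>M) = 0" if ij: "i < n" "j < n" "i \<noteq> j" for i j
  proof -
    have prod: "integrable M (\<lambda>\<omega>. (Y (\<xi> i \<omega>) \<bullet> b) * (Y (\<xi> j \<omega>) \<bullet> b)) \<and>
        (\<integral>\<omega>. (Y (\<xi> i \<omega>) \<bullet> b) * (Y (\<xi> j \<omega>) \<bullet> b) \<partial>M) = 0" for b
    proof -
      have "indep_vars (\<lambda>_. borel) (\<lambda>k \<omega>. Y (\<xi> k \<omega>) \<bullet> b) {..<n}"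
        by (rule indep_vars_compose2[OF indep]) measurable
      then have pair: "indep_vars (\<lambda>_. borel) (\<lambda>k \<omega>. Y (\<xi> k \<omega>) \<bullet> b) {i, j}"
        by (rule indep_vars_subset) (use ij in auto)
      have "integrable M (\<lambda>\<omega>. Y (\<xi> k \<omega>) \<bullet> b)" if "k \<in> {i, j}" for k
        using that ij by (intro transfer_int coord_int) auto
      from indep_vars_lebesgue_integral[OF _ pair this] indep_vars_integrable[OF _ pair this]
      show ?thesis
        using ij transfer[of i "\<lambda>x. Y x \<bullet> b"] coord_mean by simp
    qed
    then show ?thesis
      by (subst euclidean_inner) (simp add: Bochner_Integration.integral_sum)
  qed
  have diag: "(\<integral>\<omega>. Y (\<xi> i \<omega>) \<bullet> Y (\<xi> i \<omega>) \<partial>M) \<le> L\<^sup>2" if "i < n" for i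
  proof -
    have ff: "integrable N (\<lambda>x. f x \<bullet> f x)"
      using L by (intro N.integrable_const_bound[of _ "L\<^sup>2"])
        (auto simp: power2_norm_eq_inner[symmetric] intro!: power_mono)
    have "(\<integral>\<omega>. Y (\<xi> i \<omega>) \<bullet> Y (\<xi> i \<omega>) \<partial>M) = (\<integral>x. Y x \<bullet> Y x \<partial>N)"
      using that by (intro transfer) auto
    also have "\<dots> = (\<integral>x. f x \<bullet> f x - 2 * (f x \<bullet> G) + G \<bullet> G \<partial>N)"
      by (simp add: Y_def inner_diff_left inner_diff_right inner_commute algebra_simps)
    also have "\<dots> = (\<integral>x. f x \<bullet> f x \<partial>N) - G \<bullet> G"
      using ff f_int by (simp add: G_def N.prob_space)
    also have "\<dots> \<le> (\<integral>x. f x \<bullet> f x \<partial>N)" by simp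
    also have "\<dots> \<le> (\<integral>x. L\<^sup>2 \<partial>N)"
      using L ff by (intro integral_mono) (auto simp: power2_norm_eq_inner[symmetric] intro!: power_mono)
    finally show ?thesis by (simp add: N.prob_space)
  qed
  let ?Z = "\<lambda>\<omega>. (1 / real n)\<^sup>2 * (\<Sum>i<n. \<Sum>j<n. Y (\<xi> i \<omega>) \<bullet> Y (\<xi> j \<omega>))"
  have expand: "(norm ((1 / real n) *\<^sub>R (\<Sum>i<n. f (\<xi> i \<omega>)) - G))\<^sup>2 = ?Z \<omega>" for \<omega>
  proof -
    have "(1 / real n) *\<^sub>R (\<Sum>i<n. f (\<xi> i \<omega>)) - G = (1 / real n) *\<^sub>R (\<Sum>i<n. Y (\<xi> i \<omega>))"
      using \<open>n \<ge> 1\<close> by (simp add: Y_def sum_subtractf scaleR_diff_right sum_constant_scaleR)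
    moreover have "(norm (\<Sum>i<n. Y (\<xi> i \<omega>)))\<^sup>2 = (\<Sum>i<n. \<Sum>j<n. Y (\<xi> i \<omega>) \<bullet> Y (\<xi> j \<omega>))"
      by (simp add: power2_norm_eq_inner inner_sum_left inner_sum_right inner_commute)
    ultimately show ?thesis
      by (simp add: power_divide)
  qed
  have "(\<integral>\<omega>. (\<Sum>i<n. \<Sum>j<n. Y (\<xi> i \<omega>) \<bullet> Y (\<xi> j \<omega>)) \<partial>M)
      = (\<Sum>i<n. \<integral>\<omega>. (\<Sum>j<n. Y (\<xi> i \<omega>) \<bullet> Y (\<xi> j \<omega>)) \<partial>M)"
    by (intro Bochner_Integration.integral_sum Bochner_Integration.integrable_sum YY_int) auto
  also have "\<dots> = (\<Sum>i<n. \<Sum>j<n. (\<integral>\<omega>. Y (\<xi> i \<omega>) \<bullet> Y (\<xi> j \<omega>) \<partial>M))"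
    by (intro sum.cong refl Bochner_Integration.integral_sum YY_int) auto
  finally have "(\<integral>\<omega>. ?Z \<omega> \<partial>M) = (1 / real n)\<^sup>2 * (\<Sum>i<n. \<Sum>j<n. (\<integral>\<omega>. Y (\<xi> i \<omega>) \<bullet> Y (\<xi> j \<omega>) \<partial>M))"
    by simp
  also have "(\<Sum>i<n. \<Sum>j<n. (\<integral>\<omega>. Y (\<xi> i \<omega>) \<bullet> Y (\<xi> j \<omega>) \<partial>M))
      = (\<Sum>i<n. \<Sum>j<n. if i = j then (\<integral>\<omega>. Y (\<xi> i \<omega>) \<bullet> Y (\<xi> i \<omega>) \<partial>M) else 0)"
    using cross by (intro sum.cong refl) auto
  also have "\<dots> = (\<Sum>i<n. \<integral>\<omega>. Y (\<xi> i \<omega>) \<bullet> Y (\<xi> i \<omega>) \<partial>M)"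
    by simp
  also have "\<dots> \<le> (\<Sum>i<n. L\<^sup>2)"
    using diag by (intro sum_mono) simp
  also have "(1 / real n)\<^sup>2 * (\<Sum>i<n. L\<^sup>2) = L\<^sup>2 / real n"
    by (simp add: power2_eq_square)
  finally have "(\<integral>\<omega>. ?Z \<omega> \<partial>M) \<le> L\<^sup>2 / real n"
    by (simp add: mult_left_mono)
  moreover have "(\<integral>\<^sup>+\<omega>. ennreal (?Z \<omega>) \<partial>M) = ennreal (\<integral>\<omega>. ?Z \<omega> \<partial>M)"
  proof (rule nn_integral_eq_integral)
    show "integrable M ?Z"
      by (intro integrable_mult_right Bochner_Integration.integrable_sum YY_int) auto
    show "AE \<omega> in M. 0 \<le> ?Z \<omega>"
      by (rule AE_I2) (simp flip: expand)
  qed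
  ultimately show ?thesis
    unfolding expand[symmetric] G_def[symmetric] by (simp add: ennreal_leI)
qed

lemma clipped_sgd_in_cball:
  assumes "0 \<le> r" "z0 \<in> cball 0 r"
  shows "clipped_sgd l' r step m \<gamma> z0 xs k \<in> cball 0 r"
  using assms closest_point_in_set[of "cball 0 r"] by (cases k) (auto simp: Let_def simp del: mem_cball)

text \<open>The iterate \<open>k\<close> depends only on the batches before \<open>k\<close>; this is what makes it independent of
  batch \<open>k\<close>.\<close>

lemma clipped_sgd_cong:
  assumes "\<And>j i. j < k \<Longrightarrow> i < m j \<Longrightarrow> xs j i = ys j i"
  shows "clipped_sgd l' r step m \<gamma> z0 xs k = clipped_sgd l' r step m \<gamma> z0 ys k"
  using assms
proof (induction k)
  case (Suc k)
  then have "batch_gradient l' (m k) (xs k) = batch_gradient l' (m k) (ys k)"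
    by (auto simp: batch_gradient_def fun_eq_iff)
  with Suc show ?case by simp
qed simp

lemma measurable_batch_gradient:
  fixes l' :: "'x \<Rightarrow> 'a::euclidean_space \<Rightarrow> 'a"
  assumes l': "(\<lambda>(x, z). l' x z) \<in> borel_measurable (S \<Otimes>\<^sub>M restrict_space borel C)"
    and xs: "\<And>i. i < n \<Longrightarrow> (\<lambda>y. xs y i) \<in> measurable N S"
    and z: "z \<in> measurable N (restrict_space borel C)"
  shows "(\<lambda>y. batch_gradient l' n (xs y) (z y)) \<in> borel_measurable N"
proof -
  have "(\<lambda>y. l' (xs y i) (z y)) \<in> borel_measurable N" if "i < n" for i
    using measurable_compose[OF measurable_Pair[OF xs[OF that] z] l'] by simp
  then show ?thesis
    unfolding batch_gradient_def by (intro borel_measurable_scaleR borel_measurable_sum) auto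
qed

lemma measurable_clipped_sgd:
  fixes l' :: "'x \<Rightarrow> 'a::euclidean_space \<Rightarrow> 'a"
  assumes l': "(\<lambda>(x, z). l' x z) \<in> borel_measurable (S \<Otimes>\<^sub>M restrict_space borel (cball 0 r))"
    and xs: "\<And>j i. j < k \<Longrightarrow> i < m j \<Longrightarrow> (\<lambda>y. xs y j i) \<in> measurable N S"
    and r: "0 \<le> r" "z0 \<in> cball 0 r"
  shows "(\<lambda>y. clipped_sgd l' r step m \<gamma> z0 (xs y) k) \<in> measurable N (restrict_space borel (cball 0 r))"
  using xs
proof (induction k)
  case 0
  show ?case
    using r by (auto intro!: measurable_restrict_space2)
next
  case (Suc k)
  then have IH: "(\<lambda>y. clipped_sgd l' r step m \<gamma> z0 (xs y) k) \<in> measurable N (restrict_space borel (cball 0 r))"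
    by simp
  have z [measurable]: "(\<lambda>y. clipped_sgd l' r step m \<gamma> z0 (xs y) k) \<in> borel_measurable N"
    using IH by (simp add: measurable_restrict_space2_iff)
  have v [measurable]: "(\<lambda>y. batch_gradient l' (m k) (xs y k) (clipped_sgd l' r step m \<gamma> z0 (xs y) k))
      \<in> borel_measurable N"
    using Suc.prems by (intro measurable_batch_gradient[OF l' _ IH]) auto
  have [measurable]: "clip_factor \<gamma> \<in> borel_measurable (borel :: 'a measure)"
    unfolding clip_factor_def by measurable
  have P: "closest_point (cball 0 r) \<in> borel_measurable (borel :: 'a measure)"
    using r by (intro borel_measurable_continuous_onI continuous_on_closest_point) auto
  have "(\<lambda>y. clipped_sgd l' r step m \<gamma> z0 (xs y) (Suc k)) \<in> borel_measurable N"
    unfolding clipped_sgd.simps Let_def by (rule measurable_compose[OF _ P]) measurable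
  then show ?case
    using clipped_sgd_in_cball[OF r] by (intro measurable_restrict_space2 Pi_I)
qed

text \<open>The current iterate is a function of the earlier batches and so is independent of the current
  one.  With the past frozen it is a constant in the ball, at which
  \<open>nn_integral_norm_mean_sq_le\<close> bounds the error.\<close>

lemma (in prob_space) batch_gradient_mean_sq_error:
  fixes l' :: "'x \<Rightarrow> 'b::euclidean_space \<Rightarrow> 'b" and step :: "nat \<Rightarrow> real" and \<gamma> :: real
  assumes fresh: "fresh_iid_batches M \<mu> m \<xi>" and m: "\<And>k. m k \<ge> 1"
    and l': "(\<lambda>(x, z). l' x z) \<in> borel_measurable (\<mu> \<Otimes>\<^sub>M restrict_space borel (cball 0 r))"
    and L: "\<And>x z. x \<in> space \<mu> \<Longrightarrow> z \<in> cball 0 r \<Longrightarrow> norm (l' x z) \<le> L"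
    and r: "0 \<le> r" "z0 \<in> cball 0 r"
  defines "E \<equiv> \<lambda>k \<omega>. (norm
      (batch_gradient l' (m k) (\<lambda>i. \<xi> k i \<omega>) (clipped_sgd l' r step m \<gamma> z0 (\<lambda>j i. \<xi> j i \<omega>) k)
       - (\<integral>x. l' x (clipped_sgd l' r step m \<gamma> z0 (\<lambda>j i. \<xi> j i \<omega>) k) \<partial>\<mu>)))\<^sup>2"
  shows "E k \<in> borel_measurable M"
    and "(\<integral>\<^sup>+\<omega>. ennreal (E k \<omega>) \<partial>M) \<le> ennreal (L\<^sup>2 / real (m k))"
proof -
  define new where "new = {k} \<times> {..<m k}"
  define old where "old = (SIGMA j:{..<k}. {..<m j})"
  let ?new = "PiM new (\<lambda>_. \<mu>)" and ?old = "PiM old (\<lambda>_. \<mu>)"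
  let ?B = "restrict_space borel (cball (0::'b) r)"
  define Xn where "Xn = samples_at \<xi> new"
  define Xo where "Xo = samples_at \<xi> old"
  have indep: "indep_var ?new Xn ?old Xo"
    using fresh by (auto simp: fresh_iid_batches_def Let_def new_def old_def Xn_def Xo_def)
  have batch: "indep_vars (\<lambda>_. \<mu>) (\<xi> k) {..<m k}"
    and law: "\<And>i. i < m k \<Longrightarrow> distr M \<mu> (\<xi> k i) = \<mu>"
    and \<xi>: "\<And>j i. i < m j \<Longrightarrow> \<xi> j i \<in> measurable M \<mu>"
    using fresh by (auto simp: fresh_iid_batches_def)
  interpret \<mu>: prob_space \<mu>
    using prob_space_distr[OF \<xi>[of 0 k]] law[of 0] m[of k] by auto
  define G where "G z = (\<integral>x. l' x z \<partial>\<mu>)" for z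
  define Z where "Z y = clipped_sgd l' r step m \<gamma> z0 (\<lambda>j i. y (j, i)) k" for y :: "nat \<times> nat \<Rightarrow> 'x"
  define H where "H = (\<lambda>(x, y). (norm (batch_gradient l' (m k) (\<lambda>i. x (k, i)) (Z y) - G (Z y)))\<^sup>2)"
  have Z: "Z \<in> measurable ?old ?B"
    unfolding Z_def
    by (rule measurable_clipped_sgd[OF l' _ r]) (auto simp: old_def intro!: measurable_component_singleton)
  have G: "G \<in> borel_measurable ?B"
    unfolding G_def
  proof (rule \<mu>.borel_measurable_lebesgue_integral)
    show "(\<lambda>(z, x). l' x z) \<in> borel_measurable (?B \<Otimes>\<^sub>M \<mu>)"
      using measurable_compose[OF measurable_pair_swap' l'] by (simp add: case_prod_unfold)
  qed
  have H [measurable]: "H \<in> borel_measurable (?new \<Otimes>\<^sub>M ?old)"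
  proof -
    have Z2: "(\<lambda>p. Z (snd p)) \<in> measurable (?new \<Otimes>\<^sub>M ?old) ?B"
      by (rule measurable_compose[OF measurable_snd Z])
    have "(\<lambda>p. batch_gradient l' (m k) (\<lambda>i. fst p (k, i)) (Z (snd p))) \<in> borel_measurable (?new \<Otimes>\<^sub>M ?old)"
      by (rule measurable_batch_gradient[OF l' _ Z2])
        (auto simp: new_def intro!: measurable_compose[OF measurable_fst] measurable_component_singleton)
    moreover have "(\<lambda>p. G (Z (snd p))) \<in> borel_measurable (?new \<Otimes>\<^sub>M ?old)"
      by (rule measurable_compose[OF Z2 G])
    ultimately show ?thesis
      by (simp add: H_def case_prod_unfold)
  qed
  \<comment> \<open>Freshness of the batch turns the joint law of past and present samples into a product, so
    the past can be frozen and Fubini applies.\<close>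
  have rv [measurable]: "Xn \<in> measurable M ?new" "Xo \<in> measurable M ?old"
    and joint: "distr M (?new \<Otimes>\<^sub>M ?old) (\<lambda>\<omega>. (Xn \<omega>, Xo \<omega>)) = distr M ?new Xn \<Otimes>\<^sub>M distr M ?old Xo"
    using indep unfolding indep_var_distribution_eq by auto
  have E_eq: "E k = (\<lambda>\<omega>. H (Xn \<omega>, Xo \<omega>))"
  proof
    fix \<omega>
    have Z_eq: "Z (Xo \<omega>) = clipped_sgd l' r step m \<gamma> z0 (\<lambda>j i. \<xi> j i \<omega>) k"
      unfolding Z_def by (rule clipped_sgd_cong) (simp add: Xo_def samples_at_def old_def)
    have "batch_gradient l' (m k) (\<lambda>i. Xn \<omega> (k, i)) z = batch_gradient l' (m k) (\<lambda>i. \<xi> k i \<omega>) z" for z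
      by (simp add: batch_gradient_def Xn_def samples_at_def new_def)
    then show "E k \<omega> = H (Xn \<omega>, Xo \<omega>)"
      by (simp add: E_def H_def Z_eq G_def)
  qed
  show "E k \<in> borel_measurable M"
    unfolding E_eq by measurable
  interpret Pn: prob_space "distr M ?new Xn" by (rule prob_space_distr) measurable
  interpret Po: prob_space "distr M ?old Xo" by (rule prob_space_distr) measurable
  interpret P: pair_sigma_finite "distr M ?new Xn" "distr M ?old Xo" ..
  have inner: "(\<integral>\<^sup>+x. ennreal (H (x, y)) \<partial>distr M ?new Xn) \<le> ennreal (L\<^sup>2 / real (m k))"
    if y: "y \<in> space ?old" for y
  proof -
    have z: "Z y \<in> cball 0 r"
      unfolding Z_def by (rule clipped_sgd_in_cball[OF r])
    have "Z y \<in> space ?B" using z by (simp add: space_restrict_space)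
    then have f: "(\<lambda>x. l' x (Z y)) \<in> borel_measurable \<mu>"
      using measurable_compose[OF measurable_Pair2' l'] by simp
    have "(\<integral>\<^sup>+x. ennreal (H (x, y)) \<partial>distr M ?new Xn) = (\<integral>\<^sup>+\<omega>. ennreal (H (Xn \<omega>, y)) \<partial>M)"
      using y by (intro nn_integral_distr) measurable
    also have "\<dots> = (\<integral>\<^sup>+\<omega>. ennreal ((norm ((1 / real (m k)) *\<^sub>R (\<Sum>i<m k. l' (\<xi> k i \<omega>) (Z y))
        - (\<integral>x. l' x (Z y) \<partial>\<mu>)))\<^sup>2) \<partial>M)"
      by (simp add: H_def batch_gradient_def Xn_def samples_at_def new_def G_def)
    also have "\<dots> \<le> ennreal (L\<^sup>2 / real (m k))"
      using L[OF _ z] m[of k] by (intro nn_integral_norm_mean_sq_le[OF batch law f]) auto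
    finally show ?thesis .
  qed
  have "(\<integral>\<^sup>+\<omega>. ennreal (E k \<omega>) \<partial>M)
      = (\<integral>\<^sup>+p. ennreal (H p) \<partial>distr M (?new \<Otimes>\<^sub>M ?old) (\<lambda>\<omega>. (Xn \<omega>, Xo \<omega>)))"
    unfolding E_eq by (subst nn_integral_distr) measurable
  also have "\<dots> = (\<integral>\<^sup>+y. \<integral>\<^sup>+x. ennreal (H (x, y)) \<partial>distr M ?new Xn \<partial>distr M ?old Xo)"
    unfolding joint by (subst P.nn_integral_snd[symmetric]) (simp_all add: case_prod_unfold)
  also have "\<dots> \<le> (\<integral>\<^sup>+y. ennreal (L\<^sup>2 / real (m k)) \<partial>distr M ?old Xo)"
    by (rule nn_integral_mono) (simp add: inner)
  also have "\<dots> = ennreal (L\<^sup>2 / real (m k))"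
    by (simp add: Po.emeasure_space_1[simplified])
  finally show "(\<integral>\<^sup>+\<omega>. ennreal (E k \<omega>) \<partial>M) \<le> ennreal (L\<^sup>2 / real (m k))" .
qed

section \<open>Almost sure convergence\<close>

text \<open>Monotone convergence: a series of nonnegative variables with a finite mean is finite almost
  surely.\<close>

lemma AE_summable_if_summable_mean:
  fixes E :: "nat \<Rightarrow> 'a \<Rightarrow> real"
  assumes "\<And>k. E k \<in> borel_measurable M" "\<And>k \<omega>. 0 \<le> E k \<omega>"
    and "\<And>k. (\<integral>\<^sup>+\<omega>. ennreal (E k \<omega>) \<partial>M) \<le> ennreal (c k)" "summable c" "\<And>k. 0 \<le> c k"
  shows "AE \<omega> in M. summable (\<lambda>k. E k \<omega>)"
proof -
  have "(\<integral>\<^sup>+\<omega>. (\<Sum>k. ennreal (E k \<omega>)) \<partial>M) = (\<Sum>k. \<integral>\<^sup>+\<omega>. ennreal (E k \<omega>) \<partial>M)"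
    using assms(1) by (intro nn_integral_suminf) measurable
  also have "\<dots> \<le> (\<Sum>k. ennreal (c k))"
    using assms(3) by (intro suminf_le) auto
  finally have "(\<integral>\<^sup>+\<omega>. (\<Sum>k. ennreal (E k \<omega>)) \<partial>M) \<noteq> \<infinity>"
    using ennreal_suminf_neq_top[OF assms(4,5)] by (auto simp: top_unique)
  then have "AE \<omega> in M. (\<Sum>k. ennreal (E k \<omega>)) \<noteq> \<infinity>"
    using assms(1) by (intro nn_integral_PInf_AE) measurable
  then show ?thesis
    by eventually_elim (use assms(2) summable_suminf_not_top in auto)
qed

text \<open>By \<open>batch_gradient_mean_sq_error\<close> the means of the squared errors weighted by the stepsizes are
  of order \<open>step k / m k\<close>, so almost surely these errors are summable.  On each such outcome
  \<open>clipped_step_contracts\<close> is a recursion for the squared distance to \<open>zs\<close> to which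
  \<open>perturbed_contraction_tendsto_0\<close> applies.\<close>

proposition (in prob_space) clipped_sgd_converges:
  fixes l' :: "'x \<Rightarrow> 'b::euclidean_space \<Rightarrow> 'b"
  assumes fresh: "fresh_iid_batches M \<mu> m \<xi>" and m: "\<And>k. m k \<ge> 1"
    and l': "(\<lambda>(x, z). l' x z) \<in> borel_measurable (\<mu> \<Otimes>\<^sub>M restrict_space borel (cball 0 r))"
    and L: "\<And>x z. x \<in> space \<mu> \<Longrightarrow> z \<in> cball 0 r \<Longrightarrow> norm (l' x z) \<le> L" "0 < L"
    and r: "0 \<le> r" "z0 \<in> cball 0 r" and zs: "zs \<in> cball 0 r"
    and c: "0 < c"
      "\<And>z. z \<in> cball 0 r \<Longrightarrow> c * (norm (z - zs))\<^sup>2 \<le> (\<integral>x. l' x z \<partial>\<mu>) \<bullet> (z - zs)"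
    and step: "\<And>k. 0 \<le> step k" "filterlim (\<lambda>n. \<Sum>k<n. step k) at_top sequentially"
      "summable (\<lambda>k. (step k)\<^sup>2)" "summable (\<lambda>k. step k / real (m k))"
    and "0 < \<gamma>"
  shows "AE \<omega> in M. (\<lambda>k. clipped_sgd l' r step m \<gamma> z0 (\<lambda>k i. \<xi> k i \<omega>) k) \<longlonglongrightarrow> zs"
proof -
  define z where "z k \<omega> = clipped_sgd l' r step m \<gamma> z0 (\<lambda>j i. \<xi> j i \<omega>) k" for k \<omega>
  define v where "v k \<omega> = batch_gradient l' (m k) (\<lambda>i. \<xi> k i \<omega>) (z k \<omega>)" for k \<omega>
  define G where "G w = (\<integral>x. l' x w \<partial>\<mu>)" for w
  define E where "E k \<omega> = (norm (v k \<omega> - G (z k \<omega>)))\<^sup>2" for k \<omega>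
  define p where "p = min 1 (\<gamma> / L) * c"
  have p: "0 < p" using L c \<open>0 < \<gamma>\<close> by (simp add: p_def)
  have "\<xi> 0 0 \<in> measurable M \<mu>" "distr M \<mu> (\<xi> 0 0) = \<mu>"
    using fresh m[of 0] by (auto simp: fresh_iid_batches_def)
  then interpret \<mu>: prob_space \<mu>
    using prob_space_distr by metis
  have E: "E k \<in> borel_measurable M" "(\<integral>\<^sup>+\<omega>. ennreal (E k \<omega>) \<partial>M) \<le> ennreal (L\<^sup>2 / real (m k))" for k
    using batch_gradient_mean_sq_error[OF fresh m l' L(1) r, where k = k and step = step and \<gamma> = \<gamma>]
    unfolding E_def v_def z_def G_def by auto
  have "AE \<omega> in M. summable (\<lambda>k. step k * E k \<omega>)"
  proof (rule AE_summable_if_summable_mean)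
    fix k
    have "(\<integral>\<^sup>+\<omega>. ennreal (step k * E k \<omega>) \<partial>M) = ennreal (step k) * (\<integral>\<^sup>+\<omega>. ennreal (E k \<omega>) \<partial>M)"
      using step(1) E(1)[of k] by (simp add: ennreal_mult' nn_integral_cmult)
    also have "\<dots> \<le> ennreal (step k) * ennreal (L\<^sup>2 / real (m k))"
      by (intro mult_left_mono E) simp
    also have "\<dots> = ennreal (L\<^sup>2 * (step k / real (m k)))"
      using step(1) by (simp add: ennreal_mult'[symmetric] mult.commute)
    finally show "(\<integral>\<^sup>+\<omega>. ennreal (step k * E k \<omega>) \<partial>M) \<le> ennreal (L\<^sup>2 * (step k / real (m k)))" .
    show "(\<lambda>\<omega>. step k * E k \<omega>) \<in> borel_measurable M"
      using E(1) by measurable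
    show "summable (\<lambda>k. L\<^sup>2 * (step k / real (m k)))"
      using step(4) by (rule summable_mult)
    show "0 \<le> step k * E k \<omega>" "0 \<le> L\<^sup>2 * (step k / real (m k))" for \<omega>
      using step(1) by (simp_all add: E_def)
  qed
  then have "AE \<omega> in M. (\<lambda>k. z k \<omega>) \<longlonglongrightarrow> zs"
  proof eventually_elim
    fix \<omega> assume sum: "summable (\<lambda>k. step k * E k \<omega>)"
    have z_in: "z k \<omega> \<in> cball 0 r" for k
      unfolding z_def by (rule clipped_sgd_in_cball[OF r])
    have G_le: "norm (G w) \<le> L" if "w \<in> cball 0 r" for w
    proof (cases "integrable \<mu> (\<lambda>x. l' x w)")
      case True
      have "norm (G w) \<le> (\<integral>x. norm (l' x w) \<partial>\<mu>)"
        unfolding G_def by (rule integral_norm_bound)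
      also have "\<dots> \<le> L"
        using True L(1)[OF _ that] by (intro \<mu>.integral_le_const) auto
      finally show ?thesis .
    qed (use \<open>0 < L\<close> in \<open>simp add: G_def not_integrable_integral_eq\<close>)
    have "(\<lambda>k. (norm (z k \<omega> - zs))\<^sup>2) \<longlonglongrightarrow> 0"
    proof (rule perturbed_contraction_tendsto_0)
      show "(norm (z (Suc k) \<omega> - zs))\<^sup>2 \<le> (norm (z k \<omega> - zs))\<^sup>2
          - (p * step k) * (norm (z k \<omega> - zs))\<^sup>2 + (step k / p * E k \<omega> + (step k)\<^sup>2 * \<gamma>\<^sup>2)" for k
        using clipped_step_contracts[OF r(1) _ \<open>0 < \<gamma>\<close> step(1)[of k] \<open>0 < L\<close> G_le[OF z_in[of k]] c(1), of zs "z k \<omega>" "v k \<omega>"]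
          c(2)[OF z_in[of k]] zs
        by (simp add: z_def[of "Suc k"] Let_def p_def E_def z_def[symmetric] v_def[symmetric] G_def[symmetric] add.assoc)
      show "summable (\<lambda>k. step k / p * E k \<omega> + (step k)\<^sup>2 * \<gamma>\<^sup>2)"
        using summable_mult[OF sum, of "1 / p"] summable_mult2[OF step(3)]
        by (intro summable_add) simp_all
      show "filterlim (\<lambda>n. \<Sum>k<n. p * step k) at_top sequentially"
        using filterlim_tendsto_pos_mult_at_top[OF tendsto_const p step(2)]
        by (simp add: sum_distrib_left)
    qed (use p step(1) in \<open>auto simp: E_def\<close>)
    then have "(\<lambda>k. sqrt ((norm (z k \<omega> - zs))\<^sup>2)) \<longlonglongrightarrow> sqrt 0"
      by (rule tendsto_real_sqrt)
    then show "(\<lambda>k. z k \<omega>) \<longlonglongrightarrow> zs"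
      by (simp add: tendsto_norm_zero_iff LIM_zero_iff)
  qed
  then show ?thesis by (simp add: z_def)
qed

theorem theorem4p5:
  fixes X :: "(real ^ 'm) set" and A :: "real ^ 'm ^ 'd" and b :: "real ^ 'd"
    and \<alpha> \<beta> r \<gamma> :: real
    and g :: "real ^ 'd \<Rightarrow> real" and grad_g :: "real ^ 'd \<Rightarrow> real ^ 'd"
    and M :: "'w measure" and \<xi> :: "nat \<Rightarrow> nat \<Rightarrow> 'w \<Rightarrow> real ^ 'm"
    and \<mu>bar :: "(real ^ 'm) measure"
    and l' :: "real ^ 'm \<Rightarrow> real ^ 'd \<Rightarrow> real ^ 'd"
    and z0 zbar :: "real ^ 'd"
    and step :: "nat \<Rightarrow> real" and m :: "nat \<Rightarrow> nat"
  assumes "compact X" and "\<alpha> > 0" and "\<beta> > 0"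
    and "convex_on UNIV g"
    and "\<And>u. GDERIV g u :> grad_g u"
    and "(1 / \<beta>)-lipschitz_on UNIV grad_g"
    and "prob_space M"
    and "sampling_S1 M X m \<xi> \<mu>bar \<or> sampling_S2 M X m \<xi> \<mu>bar"
    and "is_arg_min (risk \<mu>bar (loss g A b \<alpha>)) (\<lambda>_. True) zbar"
    and "r > 0"
    and "cball 0 r \<subseteq> interior (effective_domain (\<lambda>z. fenchel_conjugate g (- z /\<^sub>R \<alpha>)))"
    and "zbar \<in> cball 0 r"
    and "(\<lambda>(x, z). l' x z) \<in>
           borel_measurable (restrict_space borel X \<Otimes>\<^sub>M restrict_space borel (cball 0 r))"
    and "\<And>x z. x \<in> X \<Longrightarrow> z \<in> cball 0 r \<Longrightarrow> l' x z \<in> subdifferential (loss g A b \<alpha> x) z"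
    and "\<And>k. step k \<ge> 0" and "\<And>k. m k \<ge> 1"
    and "filterlim (\<lambda>n. \<Sum>k<n. step k) at_top sequentially"
    and "summable (\<lambda>k. (step k)\<^sup>2)"
    and "summable (\<lambda>k. step k / real (m k))"
    and "z0 \<in> cball 0 r" and "\<gamma> > 0"
  shows "AE \<omega> in M.
           (\<lambda>k. clipped_sgd l' r step m \<gamma> z0 (\<lambda>k i. \<xi> k i \<omega>) k) \<longlonglongrightarrow> zbar"
proof -
  interpret prob_space M by fact
  have \<mu>: "borel_prob_on X \<mu>bar" and fresh: "fresh_iid_batches M \<mu>bar m \<xi>"
    using \<open>sampling_S1 M X m \<xi> \<mu>bar \<or> sampling_S2 M X m \<xi> \<mu>bar\<close> borel_prob_on_empirical_measure
    unfolding sampling_S1_def sampling_S2_def by blast+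
  have sets: "sets \<mu>bar = sets (restrict_space borel X)" using \<mu> by (simp add: borel_prob_on_def)
  then have space: "space \<mu>bar = X" by (simp add: sets_eq_imp_space_eq space_restrict_space)
  interpret \<mu>bar: prob_space \<mu>bar using \<mu> by (simp add: borel_prob_on_def)
  have l'_meas: "(\<lambda>(x, z). l' x z) \<in> borel_measurable (\<mu>bar \<Otimes>\<^sub>M restrict_space borel (cball 0 r))"
    using \<open>(\<lambda>(x, z). l' x z) \<in> borel_measurable (restrict_space borel X \<Otimes>\<^sub>M restrict_space borel (cball 0 r))\<close>
      measurable_cong_sets[OF sets_pair_measure_cong[OF sets refl] refl] by blast
  obtain L c where "0 < L" "0 < c"
    and bound: "\<And>x z v. x \<in> X \<Longrightarrow> z \<in> cball 0 r \<Longrightarrow> v \<in> subdifferential (loss g A b \<alpha> x) z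
      \<Longrightarrow> norm v \<le> L"
    and mono: "\<And>x z w v. x \<in> X \<Longrightarrow> z \<in> cball 0 r \<Longrightarrow> w \<in> cball 0 r
      \<Longrightarrow> v \<in> subdifferential (loss g A b \<alpha> x) z
      \<Longrightarrow> exp (log_loss g A b \<alpha> x z) - exp (log_loss g A b \<alpha> x w) + c * (norm (z - w))\<^sup>2 \<le> v \<bullet> (z - w)"
    using loss_subgradients_bounded_and_monotone[OF assms(1,2,3,10,5,6,11)] by blast
  have l'_le: "norm (l' x z) \<le> L" if "x \<in> space \<mu>bar" "z \<in> cball 0 r" for x z
    using that assms(14) bound unfolding space by blast
  have mean_mono: "c * (norm (z - zbar))\<^sup>2 \<le> (\<integral>x. l' x z \<partial>\<mu>bar) \<bullet> (z - zbar)"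
    if z: "z \<in> cball 0 r" for z
  proof -
    let ?e = "\<lambda>z x. exp (log_loss g A b \<alpha> x z)"
    have dom: "z \<in> interior (conj_domain g \<alpha>)" "zbar \<in> interior (conj_domain g \<alpha>)"
      using z assms(11,12) by blast+
    note risk = risk_loss_eq[OF \<mu> \<open>compact X\<close>, of _ g \<alpha> A b]
    have "z \<in> space (restrict_space borel (cball 0 r))"
      using z by (simp add: space_restrict_space)
    then have "(\<lambda>x. l' x z) \<in> borel_measurable \<mu>bar"
      using measurable_compose[OF measurable_Pair2' l'_meas] by simp
    then have int: "integrable \<mu>bar (\<lambda>x. l' x z)"
      using l'_le[OF _ z] by (intro \<mu>bar.integrable_const_bound[of _ L]) auto
    have "risk \<mu>bar (loss g A b \<alpha>) zbar \<le> risk \<mu>bar (loss g A b \<alpha>) z"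
      using assms(9) by (simp add: is_arg_min_def not_less)
    then have "(\<integral>x. ?e zbar x \<partial>\<mu>bar) \<le> (\<integral>x. ?e z x \<partial>\<mu>bar)"
      unfolding risk(2)[OF dom(1)] risk(2)[OF dom(2)] by (subst (asm) ennreal_le_iff) simp_all
    \<comment> \<open>As \<open>zbar\<close> minimizes the risk, the difference of the two risks may be dropped.\<close>
    then have "c * (norm (z - zbar))\<^sup>2
        \<le> (\<integral>x. ?e z x - ?e zbar x + c * (norm (z - zbar))\<^sup>2 \<partial>\<mu>bar)"
      using risk(1)[OF dom(1)] risk(1)[OF dom(2)] by (simp add: \<mu>bar.prob_space)
    also have "\<dots> \<le> (\<integral>x. l' x z \<bullet> (z - zbar) \<partial>\<mu>bar)"
      using risk(1)[OF dom(1)] risk(1)[OF dom(2)] int mono[OF _ z assms(12)] assms(14)[OF _ z]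
      by (intro integral_mono) (auto simp: space)
    also have "\<dots> = (\<integral>x. l' x z \<partial>\<mu>bar) \<bullet> (z - zbar)"
      using int by (intro integral_inner_left)
    finally show ?thesis .
  qed
  show ?thesis
    using \<open>r > 0\<close>
    by (intro clipped_sgd_converges[OF fresh assms(16) l'_meas l'_le \<open>0 < L\<close> _ assms(20,12)
          \<open>0 < c\<close> mean_mono assms(15,17,18,19) \<open>\<gamma> > 0\<close>]) auto
qed

end
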